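(* Let $D$ be a finite digraph. The following are equivalent: 1. $D$ admits a forward weakly fundamental cycle basis. 2. $D$ admits a forward integral cycle basis. 3. $D$ admits a forward undirected cycle basis. 4. $D$ admits a forward directed cycle basis. 5. Each block of $D$ is strongly connected or a single arc.
   Context: Let $D$ be a finite digraph with vertex set $V(D)$ and arc set $A(D)$. A cycle in $D$ is a closed walk (with at least one arc, arcs pairwise distinct, arcs may be traversed in either direction) whose vertices are distinct except that the first equals the last; it is a directed cycle if every arc is traversed in its own direction. The incidence vector of a cycle $C$ has entry $1$ on arcs traversed forward, $-1$ on arcs traversed backward, $0$ on other arcs; $C$ is identified with this vector (over any field). For a field $K$, the cycle space is $\mathcal C_K(D)=\{x\in K^{A(D)} : \sum_{e\in\delta^+(v)}x(e)=\sum_{e\in\delta^-(v)}x(e)\ \forall v\in V(D)\}$. A set $\mathcal B$ of cycles is a directed cycle basis if it is a basis of $\mathcal C_{\mathbb R}(D)$; an undirected cycle basis if (reduced mod 2) it is a basis of $\mathcal C_{\mathbb F_2}(D)$ (such a set is also a directed cycle basis); an integral cycle basis if it is a cycle basis and every cycle of $D$ is an integer linear combination of the vectors in $\mathcal B$; a weakly fundamental cycle basis if it is a cycle basis and can be ordered $C_1,\dots,C_\mu$ so that each $C_i$ contains an arc not in $\bigcup_{j<i}C_j$. A cycle basis is forward if all of its cycles are directed cycles. A digraph is strongly connected if every ordered pair of vertices is joined by a directed path, and weakly connected if every two vertices are joined by a path ignoring directions. A digraph is separable if deleting some vertex leaves a digraph that is not weakly connected. The blocks of $D$ are its maximal non-separable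 (weakly connected) subgraphs.
   Formalization: The digraph is assumed to have no loops; with loops the statement fails: for an arc from u to v plus a loop at v, the whole digraph is a block that is neither strongly connected nor a single arc, yet the loop is a forward cycle basis of every kind. *)

theory Defs
  imports
    Complex_Main
    "HOL-Library.Function_Algebras"
    "HOL-Library.Z2"
    "Graph_Theory.Graph_Theory"
begin

section \<open>Cycles\<close>

text \<open>
  The digraph of arc traversals: \<open>(e, True)\<close> traverses the arc \<open>e\<close> of \<open>G\<close> forward,
  \<open>(e, False)\<close> traverses it backward. Walks in it are the walks in \<open>G\<close> that may use arcs
  in either direction.
\<close>

definition traversals :: "('a,'b) pre_digraph \<Rightarrow> ('a, 'b \<times> bool) pre_digraph" where
  "traversals G = \<lparr> verts = verts G, arcs = arcs G \<times> UNIV,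
     tail = (\<lambda>(e, fwd). if fwd then tail G e else head G e),
     head = (\<lambda>(e, fwd). if fwd then head G e else tail G e) \<rparr>"

text \<open>
  \<^const>\<open>pre_digraph.cycle\<close> already demands a nonempty closed walk without repeated vertices; the
  distinctness of the arcs excludes running through one arc forth and back.
\<close>

definition ucycle :: "('a,'b) pre_digraph \<Rightarrow> ('b \<times> bool) list \<Rightarrow> bool" where
  "ucycle G p \<longleftrightarrow> pre_digraph.cycle (traversals G) p \<and> distinct (map fst p)"

definition directed_cycle :: "('a,'b) pre_digraph \<Rightarrow> ('b \<times> bool) list \<Rightarrow> bool" where
  "directed_cycle G p \<longleftrightarrow> ucycle G p \<and> (\<forall>(e, fwd) \<in> set p. fwd)"

definition incidence :: "('b \<times> bool) list \<Rightarrow> 'b \<Rightarrow> int" where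
  "incidence p e = (if (e, True) \<in> set p then 1 else if (e, False) \<in> set p then - 1 else 0)"

text \<open>Cycles are identified with their integral incidence vectors.\<close>

definition cycles :: "('a,'b) pre_digraph \<Rightarrow> ('b \<Rightarrow> int) set" where
  "cycles G = incidence ` {p. ucycle G p}"

definition directed_cycles :: "('a,'b) pre_digraph \<Rightarrow> ('b \<Rightarrow> int) set" where
  "directed_cycles G = incidence ` {p. directed_cycle G p}"


section \<open>Cycle space and cycle bases\<close>

definition vscale :: "'k::comm_ring_1 \<Rightarrow> ('b \<Rightarrow> 'k) \<Rightarrow> 'b \<Rightarrow> 'k" where
  "vscale c x = (\<lambda>e. c * x e)"

lemma module_vscale: "module (vscale :: 'k::comm_ring_1 \<Rightarrow> ('b \<Rightarrow> 'k) \<Rightarrow> 'b \<Rightarrow> 'k)"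
  by unfold_locales (auto simp: vscale_def fun_eq_iff algebra_simps)

lemma vector_space_vscale: "vector_space (vscale :: 'k::field \<Rightarrow> ('b \<Rightarrow> 'k) \<Rightarrow> 'b \<Rightarrow> 'k)"
  by unfold_locales (auto simp: vscale_def fun_eq_iff algebra_simps)

text \<open>The space of vectors indexed by the arcs consists of the functions vanishing off the arcs.\<close>

definition cycle_space :: "('a,'b) pre_digraph \<Rightarrow> ('b \<Rightarrow> 'k::field) set" where
  "cycle_space G = {x. (\<forall>e. e \<notin> arcs G \<longrightarrow> x e = 0) \<and>
     (\<forall>v \<in> verts G. (\<Sum>e\<in>out_arcs G v. x e) = (\<Sum>e\<in>in_arcs G v. x e))}"

definition over :: "('b \<Rightarrow> int) \<Rightarrow> 'b \<Rightarrow> 'k::field" where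
  "over x = (\<lambda>e. of_int (x e))"

definition basis_of :: "('b \<Rightarrow> 'k::field) set \<Rightarrow> ('b \<Rightarrow> 'k) set \<Rightarrow> bool" where
  "basis_of B V \<longleftrightarrow> \<not> module.dependent vscale B \<and> module.span vscale B = V"

definition directed_cycle_basis :: "('a,'b) pre_digraph \<Rightarrow> ('b \<Rightarrow> int) set \<Rightarrow> bool" where
  "directed_cycle_basis G B \<longleftrightarrow> B \<subseteq> cycles G \<and>
     basis_of (over ` B) (cycle_space G :: ('b \<Rightarrow> real) set)"

text \<open>
  Injectivity: the reductions mod 2 must form a basis as a family. For instance, a cycle and its
  reversal have the same reduction and cannot both belong to an undirected cycle basis.
\<close>

definition undirected_cycle_basis :: "('a,'b) pre_digraph \<Rightarrow> ('b \<Rightarrow> int) set \<Rightarrow> bool" where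
  "undirected_cycle_basis G B \<longleftrightarrow> B \<subseteq> cycles G \<and>
     inj_on (over :: _ \<Rightarrow> 'b \<Rightarrow> bit) B \<and>
     basis_of (over ` B) (cycle_space G :: ('b \<Rightarrow> bit) set)"

definition integral_cycle_basis :: "('a,'b) pre_digraph \<Rightarrow> ('b \<Rightarrow> int) set \<Rightarrow> bool" where
  "integral_cycle_basis G B \<longleftrightarrow> directed_cycle_basis G B \<and> cycles G \<subseteq> module.span vscale B"

definition weakly_fundamental_cycle_basis ::
    "('a,'b) pre_digraph \<Rightarrow> ('b \<Rightarrow> int) set \<Rightarrow> bool" where
  "weakly_fundamental_cycle_basis G B \<longleftrightarrow> directed_cycle_basis G B \<and>
     (\<exists>Cs. distinct Cs \<and> set Cs = B \<and>
        (\<forall>i < length Cs. \<exists>e \<in> arcs G. (Cs ! i) e \<noteq> 0 \<and> (\<forall>j < i. (Cs ! j) e = 0)))"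

definition forward :: "('a,'b) pre_digraph \<Rightarrow> ('b \<Rightarrow> int) set \<Rightarrow> bool" where
  "forward G B \<longleftrightarrow> B \<subseteq> directed_cycles G"


section \<open>Blocks\<close>

text \<open>
  The library's \<^const>\<open>Digraph_Component.connected\<close> (weak connectivity) and
  \<^const>\<open>strongly_connected\<close> are false for the null digraph. Deleting the only vertex of a
  digraph must not make it separable, since the null digraph has no two unjoined vertices; this is
  the reason for the nonemptiness condition.
\<close>

definition separable :: "('a,'b) pre_digraph \<Rightarrow> bool" where
  "separable G \<longleftrightarrow> (\<exists>v \<in> verts G. verts (pre_digraph.del_vert G v) \<noteq> {} \<and>
     \<not> Digraph_Component.connected (pre_digraph.del_vert G v))"

definition block :: "('a,'b) pre_digraph \<Rightarrow> ('a,'b) pre_digraph \<Rightarrow> bool" where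
  "block G H \<longleftrightarrow>
     pre_digraph.max_subgraph G (\<lambda>H. Digraph_Component.connected H \<and> \<not> separable H) H"

definition single_arc :: "('a,'b) pre_digraph \<Rightarrow> bool" where
  "single_arc H \<longleftrightarrow> (\<exists>e. arcs H = {e} \<and> verts H = {tail H e, head H e})"

text \<open>
  Finite digraphs, with parallel and antiparallel arcs allowed but without loops. Loops have to be
  excluded for the above notion of block: in the digraph with an arc from \<open>u\<close> to \<open>v\<close> and a loop at
  \<open>v\<close>, no vertex separates, so the whole digraph is a block. This block is neither strongly
  connected nor a single arc, although the loop alone is a forward cycle basis.
\<close>

locale fin_loopfree_digraph = fin_digraph + loopfree_digraph

end

theory Submission
  imports Defs
begin

text \<open>
  All five conditions are equivalent to: every arc on an undirected cycle lies on a directed cycle.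
  If the forward cycles span, an arc on an undirected cycle is in the support of some basis element.
  For the blocks, note that attaching a path to a connected non-separable subgraph at two distinct
  vertices preserves non-separability; so a block absorbs every cycle through one of its arcs, while
  a bridge can only form a block on its own.

  Conversely, the arcs on directed cycles can be ordered so that the first ones form a spanning
  forest of out-trees and each later arc closes a directed cycle with its predecessors. These
  directed cycles form a basis that is weakly fundamental. Subtracting multiples of them, the last
  one first, reduces a circulation to one on the forest, hence to zero, and this elimination works
  over every commutative ring, which yields the integral and the undirected case as well.
\<close>

section \<open>Walks in either direction\<close>

text \<open>One relation covers both kinds of reachability: \<open>S \<times> {True}\<close> allows
  only forward traversal of the arcs in \<open>S\<close>, \<open>S \<times> UNIV\<close> both
  directions.\<close>

definition steps :: "('a,'b) pre_digraph \<Rightarrow> ('b \<times> bool) set \<Rightarrow> 'a rel" where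
  "steps G T = (\<lambda>t. (tail (traversals G) t, head (traversals G) t)) ` T"

lemma steps_mono: "T \<subseteq> T' \<Longrightarrow> steps G T \<subseteq> steps G T'"
  by (auto simp: steps_def)

lemma steps_rtrancl_mono:
  "(x, y) \<in> (steps G T)\<^sup>* \<Longrightarrow> T \<subseteq> T' \<Longrightarrow> (x, y) \<in> (steps G T')\<^sup>*"
  using rtrancl_mono[OF steps_mono] by blast

lemma traversals_simps [simp]:
  "verts (traversals G) = verts G"
  "arcs (traversals G) = arcs G \<times> UNIV"
  "tail (traversals G) (e, b) = (if b then tail G e else head G e)"
  "head (traversals G) (e, b) = (if b then head G e else tail G e)"
  by (simp_all add: traversals_def)

lemma steps_forwardI: "e \<in> S \<Longrightarrow> (tail G e, head G e) \<in> steps G (S \<times> {True})"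
  by (force simp: steps_def)

lemma steps_forward: "steps G (S \<times> {True}) = (\<lambda>e. (tail G e, head G e)) ` S"
  by (force simp: steps_def)

lemma steps_undirected:
  "steps G (S \<times> UNIV) = (\<lambda>e. (tail G e, head G e)) ` S \<union> (\<lambda>e. (head G e, tail G e)) ` S"
  by (auto simp: steps_def image_iff split: if_splits) force+

lemma steps_undirected_sym:
  assumes "(x, y) \<in> (steps G (S \<times> UNIV))\<^sup>*"
  shows "(y, x) \<in> (steps G (S \<times> UNIV))\<^sup>*"
proof -
  have "sym (steps G (S \<times> UNIV))" by (auto simp: steps_undirected sym_def)
  then show ?thesis using assms by (rule symD[OF sym_rtrancl])
qed

lemma rtrancl_crosses:
  assumes "(x, y) \<in> r\<^sup>*" "x \<in> X" "y \<notin> X"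
  obtains c d where "(c, d) \<in> r" "c \<in> X" "d \<notin> X"
  using assms by (induction rule: rtrancl_induct) auto

lemma (in wf_digraph) wf_traversals: "wf_digraph (traversals G)"
  by unfold_locales (auto split: if_splits)

section \<open>Reachability, paths and cycles\<close>

context wf_digraph
begin

interpretation trav: wf_digraph "traversals G"
  by (rule wf_traversals)

text \<open>A chain of steps is first turned into a walk. Cutting out repetitions of vertices then
  leaves a path that uses no new traversals.\<close>

lemma steps_imp_apath:
  assumes "(x, y) \<in> (steps G T)\<^sup>*" "T \<subseteq> arcs G \<times> UNIV" "x \<in> verts G"
  obtains p where "trav.apath x p y" "set p \<subseteq> T"
proof -
  have "\<exists>p. trav.awalk x p y \<and> set p \<subseteq> T"
    using assms
  proof (induction rule: converse_rtrancl_induct)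
    case base
    then show ?case by (auto intro!: exI[of _ "[]"] simp: trav.awalk_Nil_iff)
  next
    case (step x z)
    obtain t where t: "t \<in> T" "x = tail (traversals G) t" "z = head (traversals G) t"
      using step.hyps(1) by (auto simp: steps_def)
    then have "t \<in> arcs (traversals G)" using step.prems by auto
    then have "z \<in> verts G" using t trav.head_in_verts by auto
    then obtain p where "trav.awalk z p y" "set p \<subseteq> T" using step.IH step.prems by auto
    then show ?case using t \<open>t \<in> arcs _\<close>
      by (intro exI[of _ "t # p"]) (auto simp: trav.awalk_Cons_iff)
  qed
  then show ?thesis
    by (meson that trav.apath_awalk_to_apath trav.awalk_to_apath_subset order_trans)
qed

lemma awalk_imp_steps:
  assumes "trav.awalk x p y"
  shows "(x, y) \<in> (steps G (set p))\<^sup>*"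
  using assms
proof (induction p arbitrary: x)
  case Nil
  then show ?case by (simp add: trav.awalk_Nil_iff)
next
  case (Cons t p)
  then have "(x, head (traversals G) t) \<in> steps G (set (t # p))"
    by (auto simp: trav.awalk_Cons_iff steps_def)
  moreover have "(head (traversals G) t, y) \<in> (steps G (set (t # p)))\<^sup>*"
    using Cons.IH Cons.prems rtrancl_mono[OF steps_mono, of "set p" "set (t # p)" G]
    by (simp only: trav.awalk_Cons_iff) (meson set_subset_Cons subsetD)
  ultimately show ?case by (rule converse_rtrancl_into_rtrancl)
qed

text \<open>A second traversal of the first arc, in whichever direction, would put both ends of that
  arc among the later vertices, so the path would revisit its start.\<close>

lemma apath_distinct_fst:
  assumes "trav.apath x p y"
  shows "distinct (map fst p)"
  using assms
proof (induction p arbitrary: x)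
  case (Cons t p)
  obtain e b where t: "t = (e, b)" by (cases t)
  have "(e, b') \<notin> set p" for b'
  proof
    assume "(e, b') \<in> set p"
    then have "tail G e \<in> set (trav.awalk_verts (head (traversals G) t) p)"
      "head G e \<in> set (trav.awalk_verts (head (traversals G) t) p)"
      using trav.awalk_verts_arc1[of "(e, b')" p]
        trav.awalk_verts_arc2[of "head (traversals G) t" p y "(e, b')"] Cons.prems
      by (auto simp: trav.apath_Cons_iff trav.awalkI_apath split: if_splits)
    then show False using Cons.prems t by (auto simp: trav.apath_Cons_iff split: if_splits)
  qed
  then show ?case using Cons t by (auto simp: trav.apath_Cons_iff)
qed simp

text \<open>Any return from head to tail can be shortened to a path, which closes up with
  \<open>e\<close>. Since \<open>T\<close> avoids \<open>e\<close>, no arc is run twice. If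
  \<open>T\<close> is forward only, the cycle is directed.\<close>

lemma ucycle_through:
  assumes "e \<in> arcs G" "(head G e, tail G e) \<in> (steps G T)\<^sup>*" "T \<subseteq> (arcs G - {e}) \<times> UNIV"
  obtains p where "ucycle G ((e, True) # p)" "set p \<subseteq> T"
proof -
  obtain p where p: "trav.apath (head G e) p (tail G e)" "set p \<subseteq> T"
    using steps_imp_apath[of "head G e" "tail G e" T] assms by auto
  have "trav.awalk (tail G e) ((e, True) # p) (tail G e)"
    using p assms by (auto simp: trav.awalk_Cons_iff trav.awalkI_apath)
  then have "trav.cycle ((e, True) # p)"
    using p by (auto simp: trav.cycle_def trav.apath_def)
  moreover have "distinct (map fst ((e, True) # p))"
    using apath_distinct_fst[OF p(1)] p(2) assms(3) by auto
  ultimately show ?thesis using that p(2) unfolding ucycle_def by blast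
qed

lemma ucycle_arcs: "ucycle G p \<Longrightarrow> fst ` set p \<subseteq> arcs G"
  by (auto simp: ucycle_def trav.cycle_def trav.awalk_def)

text \<open>Cutting the cycle at the given traversal leaves \<open>r\<close> followed by
  \<open>q\<close>, a walk from the head of the traversal to its tail.\<close>

lemma ucycle_return:
  assumes "ucycle G p" "(e, b) \<in> set p"
  shows "(head (traversals G) (e, b), tail (traversals G) (e, b)) \<in> (steps G {t \<in> set p. fst t \<noteq> e})\<^sup>*"
proof -
  obtain q r where p: "p = q @ (e, b) # r" using assms(2) by (meson split_list)
  obtain x where "trav.awalk x p x" using assms(1) by (auto simp: ucycle_def trav.cycle_def)
  then have q: "trav.awalk x q (tail (traversals G) (e, b))"
    and r: "trav.awalk (head (traversals G) (e, b)) r x"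
    by (auto simp: p trav.awalk_Cons_iff simp del: traversals_simps)
  have "set q \<subseteq> {t \<in> set p. fst t \<noteq> e}" "set r \<subseteq> {t \<in> set p. fst t \<noteq> e}"
    using assms(1) by (force simp: ucycle_def p)+
  then show ?thesis
    using awalk_imp_steps[OF q] awalk_imp_steps[OF r]
    by (meson rtrancl_mono rtrancl_trans steps_mono subsetD)
qed

end


section \<open>Circulations\<close>

text \<open>The cycle space condition over a commutative ring, so that integer vectors are covered
  as well.\<close>

definition circulation :: "('a,'b) pre_digraph \<Rightarrow> ('b \<Rightarrow> 'k::comm_ring_1) \<Rightarrow> bool" where
  "circulation G x \<longleftrightarrow> (\<forall>e. e \<notin> arcs G \<longrightarrow> x e = 0) \<and>
     (\<forall>v \<in> verts G. (\<Sum>e\<in>out_arcs G v. x e) = (\<Sum>e\<in>in_arcs G v. x e))"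

lemma cycle_space_eq: "cycle_space G = {x. circulation G x}"
  by (simp add: cycle_space_def circulation_def)

text \<open>The net outflow at \<open>v\<close>, written as a sum over all arcs: it is visibly
  linear, and a sum over vertices can be exchanged with it.\<close>

definition excess :: "('a,'b) pre_digraph \<Rightarrow> ('b \<Rightarrow> 'k::comm_ring_1) \<Rightarrow> 'a \<Rightarrow> 'k" where
  "excess G x v = (\<Sum>e\<in>arcs G. x e * (of_bool (tail G e = v) - of_bool (head G e = v)))"

context fin_digraph
begin

interpretation trav: wf_digraph "traversals G"
  by (rule wf_traversals)

lemma circulation_iff_excess:
  "circulation G x \<longleftrightarrow> (\<forall>e. e \<notin> arcs G \<longrightarrow> x e = 0) \<and> (\<forall>v \<in> verts G. excess G x v = 0)"
proof -
  have "excess G x v = (\<Sum>e\<in>out_arcs G v. x e) - (\<Sum>e\<in>in_arcs G v. x e)" for v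
  proof -
    have "(\<Sum>e\<in>arcs G. x e * of_bool (tail G e = v)) = (\<Sum>e\<in>out_arcs G v. x e)"
      by (rule sum.mono_neutral_cong_right) (auto simp: out_arcs_def)
    moreover have "(\<Sum>e\<in>arcs G. x e * of_bool (head G e = v)) = (\<Sum>e\<in>in_arcs G v. x e)"
      by (rule sum.mono_neutral_cong_right) (auto simp: in_arcs_def)
    ultimately show ?thesis
      by (simp add: excess_def right_diff_distrib sum_subtractf)
  qed
  then show ?thesis by (simp add: circulation_def)
qed

lemma excess_diff: "excess G (x - y) v = excess G x v - excess G y v"
  by (simp add: excess_def left_diff_distrib sum_subtractf)

lemma excess_scale: "excess G (vscale c x) v = c * excess G x v"
  by (simp add: excess_def vscale_def sum_distrib_left mult.assoc)

lemma excess_of_int: "excess G (of_int \<circ> x) v = of_int (excess G x v)"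
  by (simp add: excess_def)

lemma circulation_diff: "circulation G x \<Longrightarrow> circulation G y \<Longrightarrow> circulation G (x - y)"
  by (simp add: circulation_iff_excess excess_diff)

lemma circulation_scale: "circulation G x \<Longrightarrow> circulation G (vscale c x)"
  by (simp add: circulation_iff_excess excess_scale) (simp add: vscale_def)

text \<open>A walk carries one unit from \<open>x\<close> to \<open>y\<close>: along the induction
  the contributions telescope.\<close>

lemma excess_incidence:
  assumes "trav.awalk x p y" "distinct (map fst p)"
  shows "excess G (incidence p) v = of_bool (x = v) - of_bool (y = v)"
  using assms
proof (induction p arbitrary: x)
  case Nil
  then show ?case by (simp add: excess_def incidence_def trav.awalk_Nil_iff)
next
  case (Cons t p)
  obtain e b where t: "t = (e, b)" by (cases t)
  define s :: int where "s = (if b then 1 else - 1)"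
  have e: "e \<in> arcs G" using Cons.prems t by (auto simp: trav.awalk_Cons_iff)
  \<comment> \<open>The arc \<open>e\<close> does not recur in \<open>p\<close>, so its entry there
    is 0 and nothing is overwritten.\<close>
  have "incidence (t # p) = (\<lambda>f. incidence p f + (if f = e then s else 0))"
    using Cons.prems(2) by (auto simp: incidence_def t s_def fun_eq_iff image_iff)
  then have "excess G (incidence (t # p)) v
      = excess G (incidence p) v + (\<Sum>f\<in>arcs G. if f = e then s * (of_bool (tail G f = v) - of_bool (head G f = v)) else 0)"
    by (simp add: excess_def distrib_right sum.distrib if_distrib[of "\<lambda>c. c * _"] cong: if_cong)
  also have "\<dots> = excess G (incidence p) v + s * (of_bool (tail G e = v) - of_bool (head G e = v))"
    using e by simp
  also have "\<dots> = of_bool (x = v) - of_bool (y = v)"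
    using Cons t by (auto simp: trav.awalk_Cons_iff s_def)
  finally show ?case .
qed

lemma ucycle_circulation:
  assumes "ucycle G p"
  shows "circulation G (of_int \<circ> incidence p)"
proof -
  obtain x where "trav.awalk x p x" using assms by (auto simp: ucycle_def trav.cycle_def)
  then have "excess G (incidence p) v = 0" for v
    using excess_incidence assms by (fastforce simp: ucycle_def)
  moreover have "incidence p e = 0" if "e \<notin> arcs G" for e
    using that ucycle_arcs[OF assms] by (force simp: incidence_def)
  ultimately show ?thesis by (simp add: circulation_iff_excess excess_of_int)
qed

text \<open>Summing the conservation law over the side of \<open>e\<close> in \<open>G - e\<close> leaves only the value at \<open>e\<close>.\<close>

lemma circulation_support_not_bridge:
  fixes x :: "_ \<Rightarrow> 'k::comm_ring_1"
  assumes "circulation G x" "x e \<noteq> 0"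
  shows "(tail G e, head G e) \<in> (steps G ((arcs G - {e}) \<times> UNIV))\<^sup>*"
proof (rule ccontr)
  let ?r = "steps G ((arcs G - {e}) \<times> UNIV)"
  assume neg: "(tail G e, head G e) \<notin> ?r\<^sup>*"
  define W where "W = {v \<in> verts G. (tail G e, v) \<in> ?r\<^sup>*}"
  have e: "e \<in> arcs G" using assms by (auto simp: circulation_def)
  have same: "tail G f \<in> W \<longleftrightarrow> head G f \<in> W" if "f \<in> arcs G" "f \<noteq> e" for f
  proof -
    have "(tail G f, head G f) \<in> ?r" "(head G f, tail G f) \<in> ?r"
      using that by (auto simp: steps_undirected)
    then show ?thesis using that unfolding W_def by (auto intro: rtrancl_into_rtrancl)
  qed
  have W: "finite W" "W \<subseteq> verts G" by (auto simp: W_def)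
  have at: "(\<Sum>v\<in>W. of_bool (a = v)) = (of_bool (a \<in> W) :: 'k)" for a
    using W(1) by (simp add: of_bool_def)
  have "0 = (\<Sum>v\<in>W. excess G x v)"
    using assms(1) W(2) by (intro sum.neutral[symmetric]) (auto simp: circulation_iff_excess)
  also have "\<dots> = (\<Sum>f\<in>arcs G. \<Sum>v\<in>W. x f * (of_bool (tail G f = v) - of_bool (head G f = v)))"
    unfolding excess_def by (rule sum.swap)
  also have "\<dots> = (\<Sum>f\<in>arcs G. x f * (of_bool (tail G f \<in> W) - of_bool (head G f \<in> W)))"
    by (simp only: sum_distrib_left[symmetric] sum_subtractf at)
  also have "\<dots> = (\<Sum>f\<in>arcs G. if f = e then x e else 0)"
    using same neg e by (intro sum.cong) (auto simp: W_def)
  also have "\<dots> = x e" using e by simp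
  finally show False using assms(2) by simp
qed

end

section \<open>Growing a weakly fundamental basis\<close>

text \<open>\<open>S\<close> collects the arcs added so far and \<open>Cs\<close> the cycles closed
  so far. A pendant arc is the only arc of the new set at its head, so conservation there forces the
  value 0 on it. A closing arc has entry 1 in its cycle, so it can be eliminated without
  division.\<close>

inductive cyclic_growth :: "('a,'b) pre_digraph \<Rightarrow> 'b set \<Rightarrow> ('b \<Rightarrow> int) list \<Rightarrow> bool"
  for G where
    empty: "cyclic_growth G {} []"
  | pendant: "cyclic_growth G S Cs \<Longrightarrow> e \<in> arcs G \<Longrightarrow> head G e \<notin> tail G ` insert e S \<Longrightarrow>
      head G e \<notin> head G ` S \<Longrightarrow> cyclic_growth G (insert e S) Cs"
  | closing: "cyclic_growth G S Cs \<Longrightarrow> e \<notin> S \<Longrightarrow> directed_cycle G p \<Longrightarrow> (e, True) \<in> set p \<Longrightarrow>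
      set p \<subseteq> insert e S \<times> UNIV \<Longrightarrow> cyclic_growth G (insert e S) (Cs @ [incidence p])"

lemma incidence_outside: "e \<notin> fst ` set p \<Longrightarrow> incidence p e = 0"
  by (force simp: incidence_def)


text \<open>Serves twice: a cycle with a new arc is outside the span of the earlier ones, and a
  spanning set must use every arc used by a vector in its span.\<close>

lemma span_vscale_vanishing:
  fixes B :: "('b \<Rightarrow> 'k::comm_ring_1) set"
  assumes "x \<in> module.span vscale B" "\<And>y. y \<in> B \<Longrightarrow> y e = 0"
  shows "x e = 0"
proof -
  interpret module "vscale :: 'k \<Rightarrow> ('b \<Rightarrow> 'k) \<Rightarrow> 'b \<Rightarrow> 'k" by (rule module_vscale)
  show ?thesis
    using assms(1) by (induction rule: span_induct_alt) (auto simp: assms(2) vscale_def)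
qed

section \<open>Invariants, independence and span of the grown cycles\<close>

context fin_digraph
begin

interpretation trav: wf_digraph "traversals G"
  by (rule wf_traversals)

lemma cyclic_growth_arcs: "cyclic_growth G S Cs \<Longrightarrow> S \<subseteq> arcs G"
proof (induction rule: cyclic_growth.induct)
  case (closing S Cs e p)
  have "e \<in> arcs G"
    using closing.hyps(3,4) ucycle_arcs[of p] unfolding directed_cycle_def by (metis fst_conv image_eqI subsetD)
  then show ?case using closing.IH by simp
qed auto

lemma cyclic_growth_support:
  assumes "cyclic_growth G S Cs" "C \<in> set Cs" "e \<notin> S"
  shows "C e = 0"
  using assms
proof (induction rule: cyclic_growth.induct)
  case (closing S Cs f p)
  then have "e \<notin> fst ` set p" by auto
  then show ?case using closing incidence_outside[of e p] by auto
qed auto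

lemma cyclic_growth_directed_cycles: "cyclic_growth G S Cs \<Longrightarrow> set Cs \<subseteq> directed_cycles G"
  by (induction rule: cyclic_growth.induct) (auto simp: directed_cycles_def)

lemma incidence_directed: "directed_cycle G p \<Longrightarrow> (e, b) \<in> set p \<Longrightarrow> incidence p e = 1"
  by (cases b) (auto simp: directed_cycle_def incidence_def)

text \<open>The witness is the arc that closed the \<open>i\<close>-th cycle: it lay outside the arc
  set of that moment, which supports all earlier cycles.\<close>

lemma cyclic_growth_new_arcs:
  assumes "cyclic_growth G S Cs" "i < length Cs"
  shows "\<exists>e \<in> arcs G. (Cs ! i) e = 1 \<and> (\<forall>j < i. (Cs ! j) e = 0)"
  using assms
proof (induction arbitrary: i rule: cyclic_growth.induct)
  case (closing S Cs e p)
  show ?case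
  proof (cases "i < length Cs")
    case True
    then show ?thesis using closing.IH[OF True] by (auto simp: nth_append)
  next
    case False
    then have "i = length Cs" using closing.prems by simp
    moreover have "e \<in> arcs G"
      using cyclic_growth_arcs[OF cyclic_growth.closing[OF closing.hyps]] by simp
    ultimately show ?thesis
      using closing.hyps(2) cyclic_growth_support[OF closing.hyps(1)] incidence_directed[OF closing.hyps(3,4)]
      by (intro bexI[of _ e]) (auto simp: nth_append)
  qed
qed auto

lemma cyclic_growth_distinct: "cyclic_growth G S Cs \<Longrightarrow> distinct Cs"
proof -
  assume *: "cyclic_growth G S Cs"
  have "Cs ! j \<noteq> Cs ! i" if "j < i" "i < length Cs" for i j
    using cyclic_growth_new_arcs[OF * that(2)] that(1) by fastforce
  then show ?thesis unfolding distinct_conv_nth by (metis nat_neq_iff)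
qed

text \<open>The entry at the closing arc is 1, hence nonzero in every field, while all earlier
  cycles vanish there. This gives injectivity of the reduction along with independence.\<close>

lemma cyclic_growth_independent:
  assumes "cyclic_growth G S Cs"
  shows "inj_on (over :: _ \<Rightarrow> 'b \<Rightarrow> 'k::field) (set Cs) \<and>
    \<not> module.dependent vscale ((over :: _ \<Rightarrow> 'b \<Rightarrow> 'k) ` set Cs)"
  using assms
proof (induction rule: cyclic_growth.induct)
  interpret vector_space "vscale :: 'k \<Rightarrow> ('b \<Rightarrow> 'k) \<Rightarrow> 'b \<Rightarrow> 'k" by (rule vector_space_vscale)
  case empty
  then show ?case by (simp add: independent_empty)
next
  interpret vector_space "vscale :: 'k \<Rightarrow> ('b \<Rightarrow> 'k) \<Rightarrow> 'b \<Rightarrow> 'k" by (rule vector_space_vscale)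
  case (closing S Cs e p)
  have "over (incidence p) \<notin> span ((over :: _ \<Rightarrow> 'b \<Rightarrow> 'k) ` set Cs)"
  proof
    assume "over (incidence p) \<in> span ((over :: _ \<Rightarrow> 'b \<Rightarrow> 'k) ` set Cs)"
    then have "(over (incidence p) :: 'b \<Rightarrow> 'k) e = 0"
    proof (rule span_vscale_vanishing)
      show "y e = 0" if "y \<in> (over :: _ \<Rightarrow> 'b \<Rightarrow> 'k) ` set Cs" for y
        using that cyclic_growth_support[OF closing.hyps(1) _ closing.hyps(2)]
        by (force simp: over_def)
    qed
    then show False using incidence_directed[OF closing.hyps(3,4)] by (simp add: over_def)
  qed
  then have notin: "over (incidence p) \<notin> (over :: _ \<Rightarrow> 'b \<Rightarrow> 'k) ` set Cs"
    and "independent (insert (over (incidence p)) ((over :: _ \<Rightarrow> 'b \<Rightarrow> 'k) ` set Cs))"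
    using closing.IH span_base[of "over (incidence p)"] by (metis, simp add: independent_insert)
  moreover have "inj_on (over :: _ \<Rightarrow> 'b \<Rightarrow> 'k) (insert (incidence p) (set Cs))"
    using notin closing.IH by (simp add: image_def)
  ultimately show ?case by simp
qed

text \<open>The last added arc is cleared from \<open>x\<close>, and the induction hypothesis
  handles the rest.\<close>

lemma cyclic_growth_spans:
  fixes x :: "'b \<Rightarrow> 'k::comm_ring_1"
  assumes "cyclic_growth G S Cs" "circulation G x" "\<And>e. e \<notin> S \<Longrightarrow> x e = 0"
  shows "x \<in> module.span vscale ((\<lambda>C. of_int \<circ> C) ` set Cs)"
  using assms
proof (induction arbitrary: x rule: cyclic_growth.induct)
  interpret module "vscale :: 'k \<Rightarrow> ('b \<Rightarrow> 'k) \<Rightarrow> 'b \<Rightarrow> 'k" by (rule module_vscale)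
  case empty
  then have "x = 0" by (simp add: fun_eq_iff)
  then show ?case using span_zero by metis
next
  case (pendant S Cs e)
  \<comment> \<open>Any other arc at the head of \<open>e\<close> is outside the grown set, hence
    outside the support of \<open>x\<close>.\<close>
  have zero: "x f = 0" if "f \<noteq> e" "tail G f = head G e \<or> head G f = head G e" for f
  proof -
    have "f \<notin> insert e S" using pendant.hyps that by (metis imageI insert_iff)
    then show ?thesis by (rule pendant.prems)
  qed
  have "0 = excess G x (head G e)"
    using pendant by (simp add: circulation_iff_excess)
  \<comment> \<open>Only \<open>e\<close> contributes; it enters this vertex and, not being a loop,
    does not leave it.\<close>
  also have "\<dots> = (\<Sum>f\<in>arcs G. if f = e then - x e else 0)"
    unfolding excess_def using pendant.hyps zero by (intro sum.cong) auto
  also have "\<dots> = - x e"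
    using pendant.hyps by simp
  finally have "x e = 0" by simp
  then have "x f = 0" if "f \<notin> S" for f
    using pendant.prems(2)[of f] that by (cases "f = e") auto
  then show ?case using pendant.prems(1) by (rule pendant.IH[rotated])
next
  interpret module "vscale :: 'k \<Rightarrow> ('b \<Rightarrow> 'k) \<Rightarrow> 'b \<Rightarrow> 'k" by (rule module_vscale)
  case (closing S Cs e p)
  define y :: "'b \<Rightarrow> 'k" where "y = of_int \<circ> incidence p"
  \<comment> \<open>As \<open>y\<close> has entry exactly 1 at \<open>e\<close>, the multiple
    \<open>x e\<close> cancels the value at \<open>e\<close>.\<close>
  define z where "z = x - vscale (x e) y"
  have "z f = 0" if "f \<notin> S" for f
  proof (cases "f = e")
    case True
    then show ?thesis
      using incidence_directed[OF closing.hyps(3,4)] by (simp add: z_def y_def vscale_def)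
  next
    case False
    then have "f \<notin> fst ` set p" using closing.hyps that by auto
    then show ?thesis
      using closing.prems False that by (simp add: z_def y_def vscale_def incidence_outside)
  qed
  moreover have "circulation G z"
    unfolding z_def y_def using closing
    by (intro circulation_diff circulation_scale ucycle_circulation) (auto simp: directed_cycle_def)
  ultimately have "z \<in> span ((\<lambda>C. of_int \<circ> C) ` set Cs)"
    by (intro closing.IH) auto
  then have "z \<in> span ((\<lambda>C. of_int \<circ> C) ` set (Cs @ [incidence p]))"
    using span_mono[of "(\<lambda>C. of_int \<circ> C) ` set Cs" "(\<lambda>C. of_int \<circ> C) ` set (Cs @ [incidence p])"] by auto
  moreover have "y \<in> span ((\<lambda>C. of_int \<circ> C) ` set (Cs @ [incidence p]))"
    by (rule span_base) (simp add: y_def)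
  ultimately have "z + vscale (x e) y \<in> span ((\<lambda>C. of_int \<circ> C) ` set (Cs @ [incidence p]))"
    by (intro span_add span_scale)
  moreover have "z + vscale (x e) y = x" by (simp add: z_def)
  ultimately show ?case by metis
qed

section \<open>Arcs on directed cycles, and a growth that exhausts them\<close>

text \<open>These are the arcs that lie on a directed cycle.\<close>

definition returning :: "'b set" where
  "returning = {e \<in> arcs G. (head G e, tail G e) \<in> (steps G (arcs G \<times> {True}))\<^sup>*}"

text \<open>If \<open>y\<close> leads back to \<open>x\<close>, every arc on a directed walk from
  \<open>x\<close> to \<open>y\<close> lies on a closed directed walk, so it is returning
  itself.\<close>

lemma returning_steps:
  assumes "(x, y) \<in> (steps G (arcs G \<times> {True}))\<^sup>*" "(y, x) \<in> (steps G (arcs G \<times> {True}))\<^sup>*"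
  shows "(x, y) \<in> (steps G (returning \<times> {True}))\<^sup>*"
  using assms
proof (induction rule: converse_rtrancl_induct)
  case (step x z)
  then obtain e where e: "e \<in> arcs G" "x = tail G e" "z = head G e"
    by (auto simp: steps_forward)
  have "(z, x) \<in> (steps G (arcs G \<times> {True}))\<^sup>*"
    using step by (meson rtrancl_trans)
  then have "e \<in> returning" using e by (simp add: returning_def)
  then have "(x, z) \<in> steps G (returning \<times> {True})"
    using e steps_forwardI by metis
  moreover have "(y, z) \<in> (steps G (arcs G \<times> {True}))\<^sup>*"
    using step by (meson rtrancl_into_rtrancl)
  ultimately show ?case using step.IH by (meson converse_rtrancl_into_rtrancl)
qed simp

text \<open>The head and tail of a returning arc reach each other, so the backward step can be
  replaced by a directed walk of returning arcs.\<close>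

lemma sym_returning: "sym ((steps G (returning \<times> {True}))\<^sup>*)"
proof (rule symI)
  have "converse (steps G (returning \<times> {True})) \<subseteq> (steps G (returning \<times> {True}))\<^sup>*"
  proof clarify
    fix x y assume "(y, x) \<in> steps G (returning \<times> {True})"
    then obtain e where e: "e \<in> returning" "y = tail G e" "x = head G e"
      by (auto simp: steps_forward)
    then show "(x, y) \<in> (steps G (returning \<times> {True}))\<^sup>*"
      using returning_steps[of x y] steps_forwardI[of e "arcs G" G] by (auto simp: returning_def)
  qed
  then have "(converse (steps G (returning \<times> {True})))\<^sup>* \<subseteq> (steps G (returning \<times> {True}))\<^sup>*"
    by (metis rtrancl_mono rtrancl_idemp)
  then show "(y, x) \<in> (steps G (returning \<times> {True}))\<^sup>*" if "(x, y) \<in> (steps G (returning \<times> {True}))\<^sup>*" for x y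
    using that by (auto simp: rtrancl_converse)
qed

lemma maximal_subset_exists:
  assumes "finite A" "P B" "\<And>S. P S \<Longrightarrow> S \<subseteq> A"
  obtains S where "P S" "\<And>e. e \<notin> S \<Longrightarrow> \<not> P (insert e S)"
proof -
  have "finite {S. P S}" using assms(1,3) by (auto intro: finite_subset[of _ "Pow A"])
  then obtain S where "P S" "\<And>S'. P S' \<Longrightarrow> S \<subseteq> S' \<Longrightarrow> S = S'"
    using finite_has_maximal[of "{S. P S}"] assms(2) by auto
  then show ?thesis using that by blast
qed

lemma cyclic_growth_returning: "\<exists>Cs. cyclic_growth G returning Cs"
proof -
  let ?r = "\<lambda>S. steps G (S \<times> {True})"
  let ?R = "(?r returning)\<^sup>*"
  \<comment> \<open>By symmetry, all vertices of a class reach the same set of vertices, so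
    \<open>SOME\<close> picks the same representative for each of them.\<close>
  define root where "root u = (SOME w. (u, w) \<in> ?R)" for u
  have root: "(u, root u) \<in> ?R" for u
    unfolding root_def by (rule someI[of _ u]) simp
  have root_eq: "root u = root w" if "(u, w) \<in> ?R" for u w
  proof -
    have "(u, z) \<in> ?R \<longleftrightarrow> (w, z) \<in> ?R" for z
      using that sym_returning by (meson rtrancl_trans symD)
    then show ?thesis by (simp add: root_def)
  qed
  have fin: "finite returning" by (simp add: returning_def)
  \<comment> \<open>A maximal forest of out-trees from the roots spans: the first arc leaving the reached vertices is pendant.\<close>
  define reached where "reached T = {v. (root v, v) \<in> (?r T)\<^sup>*}" for T
  have r_mono: "(?r T)\<^sup>* \<subseteq> (?r T')\<^sup>*" if "T \<subseteq> T'" for T T'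
    using that by (intro rtrancl_mono steps_mono) auto
  have reached_mono: "reached T \<subseteq> reached (insert e T)" for T e
    unfolding reached_def using r_mono[of T "insert e T"] by blast
  \<comment> \<open>The empty list of cycles admits only pendant arcs. Keeping all ends of
    \<open>T\<close> among the reached vertices ensures that an unreached head is fresh.\<close>
  define P where "P T \<longleftrightarrow> cyclic_growth G T [] \<and> T \<subseteq> returning \<and>
    tail G ` T \<union> head G ` T \<subseteq> reached T" for T
  have "P {}" by (simp add: P_def cyclic_growth.empty)
  then obtain T where T: "P T" and T_max: "\<And>e. e \<notin> T \<Longrightarrow> \<not> P (insert e T)"
    by (rule maximal_subset_exists[OF fin]) (auto simp: P_def)
  have T_spans: "(root v, v) \<in> (?r T)\<^sup>*" for v
  proof (rule ccontr)
    assume "(root v, v) \<notin> (?r T)\<^sup>*"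
    then have v: "v \<notin> reached T" by (simp add: reached_def)
    have root_v: "root v \<in> reached T"
      using root_eq[OF root[of v]] by (simp add: reached_def)
    have "(root v, v) \<in> ?R" using root sym_returning by (meson symD)
    then obtain c d where "(c, d) \<in> ?r returning" "c \<in> reached T" "d \<notin> reached T"
      using root_v v by (rule rtrancl_crosses)
    then obtain e where e: "e \<in> returning" "tail G e \<in> reached T" "head G e \<notin> reached T"
      by (auto simp: steps_forward)
    have "(tail G e, head G e) \<in> ?r returning" using e(1) by (rule steps_forwardI)
    then have "root (head G e) = root (tail G e)" using root_eq by (metis r_into_rtrancl)
    moreover have "(root (tail G e), tail G e) \<in> (?r (insert e T))\<^sup>*"
      using e(2) reached_mono[of T e] unfolding reached_def by blast
    moreover have "(tail G e, head G e) \<in> ?r (insert e T)" by (rule steps_forwardI) simp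
    ultimately have "head G e \<in> reached (insert e T)"
      unfolding reached_def by (simp add: rtrancl_into_rtrancl)
    \<comment> \<open>The tail of \<open>e\<close> and all ends of \<open>T\<close> are reached
      while the head of \<open>e\<close> is not, so \<open>e\<close> is pendant.\<close>
    moreover have "cyclic_growth G (insert e T) []"
      using T e by (intro cyclic_growth.pendant) (auto simp: P_def returning_def)
    moreover have "e \<notin> T" using e T by (auto simp: P_def)
    ultimately show False
      using T_max[of e] T e reached_mono[of T e] by (auto simp: P_def)
  qed
  \<comment> \<open>A maximal \<open>S\<close> is everything: if the head of a missing arc does not reach its root in \<open>S\<close>,
    replace that arc by the one that, on a path from the head to the root, enters the set of
    vertices reaching the root in \<open>S\<close>. Its head reaches its tail in \<open>S\<close> via the root.\<close>
  define Q where "Q S \<longleftrightarrow> (\<exists>Cs. cyclic_growth G S Cs) \<and> T \<subseteq> S \<and> S \<subseteq> returning" for S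
  have "Q T" using T by (auto simp: P_def Q_def)
  then obtain S where "Q S" and S_max: "\<And>e. e \<notin> S \<Longrightarrow> \<not> Q (insert e S)"
    by (rule maximal_subset_exists[OF fin]) (auto simp: Q_def)
  then have S: "\<exists>Cs. cyclic_growth G S Cs" "T \<subseteq> S" "S \<subseteq> returning" by (auto simp: Q_def)
  have S_spans: "(root v, v) \<in> (?r S)\<^sup>*" for v
    using T_spans r_mono[OF S(2)] by blast
  have "S = returning"
  proof (rule ccontr)
    assume "S \<noteq> returning"
    then obtain f where f: "f \<in> returning" "f \<notin> S" using S by auto
    have "\<exists>e \<in> returning - S. (head G e, tail G e) \<in> (?r S)\<^sup>*"
    proof (cases "(head G f, root (head G f)) \<in> (?r S)\<^sup>*")
      case True
      have "(tail G f, head G f) \<in> ?r returning" using f(1) by (rule steps_forwardI)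
      then have "root (head G f) = root (tail G f)" using root_eq by (metis r_into_rtrancl)
      then show ?thesis using True S_spans f by (metis DiffI rtrancl_trans)
    next
      case False
      define X where "X = {v. (v, root v) \<notin> (?r S)\<^sup>*}"
      \<comment> \<open>A root is its own root and reaches itself trivially, so it lies outside
        \<open>X\<close>.\<close>
      have f_X: "head G f \<in> X" "root (head G f) \<notin> X"
        using False root_eq[OF root[of "head G f"]] by (auto simp: X_def)
      obtain c d where cd: "(c, d) \<in> ?r returning" "c \<in> X" "d \<notin> X"
        by (rule rtrancl_crosses[OF root f_X])
      then obtain e where e: "e \<in> returning" "c = tail G e" "d = head G e"
        by (auto simp: steps_forward)
      have eq: "root d = root c" using root_eq cd(1) by (metis r_into_rtrancl)
      have "e \<notin> S"
      proof
        assume "e \<in> S"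
        then have "(c, d) \<in> ?r S" using e(2,3) steps_forwardI by metis
        then show False using cd eq unfolding X_def by (auto intro: converse_rtrancl_into_rtrancl)
      qed
      moreover have "(d, c) \<in> (?r S)\<^sup>*"
        using cd(3) eq S_spans[of c] unfolding X_def by (auto intro: rtrancl_trans)
      ultimately show ?thesis using e by auto
    qed
    then obtain e where e: "e \<in> returning" "e \<notin> S" "(head G e, tail G e) \<in> (?r S)\<^sup>*" by auto
    obtain Cs where Cs: "cyclic_growth G S Cs" using S by auto
    \<comment> \<open>The return walk uses arcs of \<open>S\<close> in forward direction only, so
      the cycle is directed and \<open>e\<close> is a closing arc.\<close>
    obtain p where p: "ucycle G ((e, True) # p)" "set p \<subseteq> S \<times> {True}"
      using ucycle_through[OF _ e(3)] e S by (auto simp: returning_def)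
    have "cyclic_growth G (insert e S) (Cs @ [incidence ((e, True) # p)])"
      using Cs e p by (intro cyclic_growth.closing) (auto simp: directed_cycle_def)
    then show False using S_max[OF e(2)] e S by (auto simp: Q_def)
  qed
  then show ?thesis using S by blast
qed

text \<open>A circulation is supported on non-bridges, which by assumption are returning. So the
  grown cycles span all circulations.\<close>

lemma cyclic_growth_bases:
  assumes "cyclic_growth G returning Cs"
    and bridge_or_returning:
      "\<And>e. e \<in> arcs G \<Longrightarrow> (tail G e, head G e) \<in> (steps G ((arcs G - {e}) \<times> UNIV))\<^sup>* \<Longrightarrow> e \<in> returning"
  shows "forward G (set Cs)" "weakly_fundamental_cycle_basis G (set Cs)"
    "integral_cycle_basis G (set Cs)" "undirected_cycle_basis G (set Cs)"
proof -
  show fwd: "forward G (set Cs)"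
    using cyclic_growth_directed_cycles[OF assms(1)] by (simp add: forward_def)
  then have cycles: "set Cs \<subseteq> cycles G"
    by (auto simp: forward_def directed_cycles_def cycles_def directed_cycle_def)
  have over: "over C = of_int \<circ> C" for C by (auto simp: over_def)
  \<comment> \<open>The ring is left open, as the statement is used for arbitrary fields and for the
    integers.\<close>
  have spans: "x \<in> module.span vscale ((\<lambda>C. of_int \<circ> C) ` set Cs)" if "circulation G x"
    for x :: "'b \<Rightarrow> 'k::comm_ring_1"
    using assms(1) that
  proof (rule cyclic_growth_spans)
    show "x e = 0" if "e \<notin> returning" for e
      using that bridge_or_returning circulation_support_not_bridge[OF \<open>circulation G x\<close>]
        \<open>circulation G x\<close> by (auto simp: circulation_def)
  qed
  have basis: "basis_of (over ` set Cs) (cycle_space G :: ('b \<Rightarrow> 'k::field) set)"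
  proof -
    interpret vector_space "vscale :: 'k \<Rightarrow> ('b \<Rightarrow> 'k) \<Rightarrow> 'b \<Rightarrow> 'k" by (rule vector_space_vscale)
    have "x \<in> cycle_space G" if "x \<in> span ((over :: _ \<Rightarrow> 'b \<Rightarrow> 'k) ` set Cs)" for x
      using that
    proof (induction rule: span_induct_alt)
      case base
      show ?case by (simp add: cycle_space_def)
    next
      case (step c x y)
      then have "circulation G x"
        using cycles ucycle_circulation by (auto simp: over cycles_def)
      \<comment> \<open>The sum is written as a difference, to which the closure property of
        circulations applies.\<close>
      then have "circulation G (y - vscale (- c) x)"
        using step by (intro circulation_diff circulation_scale) (auto simp: cycle_space_eq)
      moreover have "y - vscale (- c) x = vscale c x + y" by simp
      ultimately show ?case by (metis cycle_space_eq mem_Collect_eq)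
    qed
    then show ?thesis
      using spans cyclic_growth_independent[OF assms(1)]
      by (auto simp: basis_of_def cycle_space_eq over)
  qed
  have "\<exists>e \<in> arcs G. (Cs ! i) e \<noteq> 0 \<and> (\<forall>j < i. (Cs ! j) e = 0)" if "i < length Cs" for i
    using cyclic_growth_new_arcs[OF assms(1) that] by (metis one_neq_zero)
  then show dir: "weakly_fundamental_cycle_basis G (set Cs)"
    unfolding weakly_fundamental_cycle_basis_def directed_cycle_basis_def
    by (intro conjI exI[of _ Cs] cycles basis cyclic_growth_distinct[OF assms(1)]) auto
  show "undirected_cycle_basis G (set Cs)"
    using cycles basis cyclic_growth_independent[OF assms(1), THEN conjunct1]
    unfolding undirected_cycle_basis_def by blast
  have "cycles G \<subseteq> module.span vscale (set Cs)"
  proof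
    fix x assume "x \<in> cycles G"
    then obtain p where p: "ucycle G p" "x = incidence p" by (auto simp: cycles_def)
    \<comment> \<open>Over the integers \<open>of_int\<close> is the identity, so the span obtained
      is that of \<open>set Cs\<close> itself.\<close>
    have "circulation G (of_int \<circ> incidence p :: 'b \<Rightarrow> int)" by (rule ucycle_circulation[OF p(1)])
    then have "circulation G x" using p(2) by (simp add: comp_def)
    from spans[OF this] show "x \<in> module.span vscale (set Cs)" by (simp add: comp_def)
  qed
  then show "integral_cycle_basis G (set Cs)"
    using dir by (simp add: integral_cycle_basis_def weakly_fundamental_cycle_basis_def)
qed

end

section \<open>Blocks\<close>

lemma steps_cong: "tail G = tail H \<Longrightarrow> head G = head H \<Longrightarrow> steps G T = steps H T"
  by (simp add: steps_def traversals_def cong: if_cong)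

text \<open>The arcs of \<open>S\<close> that survive the deletion of \<open>v\<close>; it makes
  sense for any \<open>v\<close>, vertex or not.\<close>

definition avoiding :: "('a,'b) pre_digraph \<Rightarrow> 'b set \<Rightarrow> 'a \<Rightarrow> 'b set" where
  "avoiding G S v = {e \<in> S. tail G e \<noteq> v \<and> head G e \<noteq> v}"

section \<open>Connectivity and separability as reachability; attaching a path\<close>

context wf_digraph
begin

interpretation trav: wf_digraph "traversals G"
  by (rule wf_traversals)

lemma rtrancl_on_verts:
  assumes "r \<subseteq> UNIV \<times> verts G" "x \<in> verts G"
  shows "(x, y) \<in> rtrancl_on (verts G) r \<longleftrightarrow> (x, y) \<in> r\<^sup>*"
proof
  show "(x, y) \<in> rtrancl_on (verts G) r" if "(x, y) \<in> r\<^sup>*"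
    using that assms
    by (induction rule: rtrancl_induct) (auto intro: rtrancl_on_into_rtrancl_on)
qed (rule rtrancl_on_rtranclI)

lemma steps_in_verts: "T \<subseteq> arcs G \<times> UNIV \<Longrightarrow> steps G T \<subseteq> UNIV \<times> verts G"
  by (auto simp: steps_def dest!: subsetD)

lemma strongly_connected_iff_steps:
  "strongly_connected G \<longleftrightarrow> verts G \<noteq> {} \<and>
    (\<forall>x \<in> verts G. \<forall>y \<in> verts G. (x, y) \<in> (steps G (arcs G \<times> {True}))\<^sup>*)"
proof -
  have "arcs_ends G = steps G (arcs G \<times> {True})"
    by (auto simp: steps_forward arcs_ends_conv)
  then show ?thesis
    using rtrancl_on_verts[OF steps_in_verts[OF Sigma_mono[OF order_refl subset_UNIV]]]
    by (auto simp: strongly_connected_def reachable_def)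
qed

lemma connected_iff_steps:
  "Digraph_Component.connected G \<longleftrightarrow> verts G \<noteq> {} \<and>
    (\<forall>x \<in> verts G. \<forall>y \<in> verts G. (x, y) \<in> (steps G (arcs G \<times> UNIV))\<^sup>*)"
proof -
  have "(arcs_ends G)\<^sup>s = steps G (arcs G \<times> UNIV)"
    by (auto simp: steps_undirected arcs_ends_conv symcl_def image_iff)
  then show ?thesis
    using rtrancl_on_verts[OF steps_in_verts[OF order_refl]]
    by (auto simp: connected_conv)
qed

text \<open>Here \<open>v\<close> may range over everything: for a non-vertex the condition is just
  connectedness, and if the deletion leaves no vertex it holds vacuously.\<close>

lemma not_separable_iff_steps:
  assumes "Digraph_Component.connected G"
  shows "\<not> separable G \<longleftrightarrow>
    (\<forall>v. \<forall>x \<in> verts G - {v}. \<forall>y \<in> verts G - {v}. (x, y) \<in> (steps G (avoiding G (arcs G) v \<times> UNIV))\<^sup>*)"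
    (is "_ \<longleftrightarrow> (\<forall>v. ?joined v)")
proof -
  have "?joined v" if "v \<notin> verts G" for v
  proof -
    have "avoiding G (arcs G) v = arcs G" using that by (auto simp: avoiding_def)
    then show ?thesis using assms that by (auto simp: connected_iff_steps)
  qed
  moreover have "?joined v \<longleftrightarrow> verts (del_vert v) = {} \<or> Digraph_Component.connected (del_vert v)" for v
    using wf_digraph.connected_iff_steps[OF wf_digraph_del_vert[of v]]
      steps_cong[of "del_vert v" G, OF tail_del_vert head_del_vert]
    by (auto simp: verts_del_vert arcs_del_vert avoiding_def)
  ultimately show ?thesis unfolding separable_def by blast
qed

text \<open>Deleting \<open>v\<close> cuts a path into at most two pieces, and each piece retains an
  end of the path.\<close>

lemma apath_avoiding:
  assumes "trav.apath a p b" "w \<in> set (trav.awalk_verts a p)" "w \<noteq> v"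
  shows "\<exists>z \<in> {a, b} - {v}. (w, z) \<in> (steps G (avoiding G (fst ` set p) v \<times> UNIV))\<^sup>*"
  using assms
proof (induction p arbitrary: a)
  case Nil
  then show ?case by auto
next
  case (Cons t p)
  define a' where "a' = head (traversals G) t"
  let ?r = "\<lambda>p. steps G (avoiding G (fst ` set p) v \<times> UNIV)"
  have t: "tail (traversals G) t = a" "trav.apath a' p b" "a \<notin> set (trav.awalk_verts a' p)"
    using Cons.prems(1) by (auto simp: trav.apath_Cons_iff a'_def)
  have mono: "(?r p)\<^sup>* \<subseteq> (?r (t # p))\<^sup>*"
    by (intro rtrancl_mono steps_mono) (auto simp: avoiding_def)
  show ?case
  proof (cases "w = a")
    case True
    then show ?thesis using Cons.prems(3) by auto
  next
    case False
    then have w: "w \<in> set (trav.awalk_verts a' p)" using Cons.prems(2) t(1) by (simp add: a'_def)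
    show ?thesis
    proof (cases "v = a")
      case True
      \<comment> \<open>The path starts at \<open>v\<close> and never comes back, so its stretch
        from \<open>w\<close> to \<open>b\<close> avoids \<open>v\<close>.\<close>
      obtain q r where qr: "p = q @ r" "trav.awalk w r b"
        using trav.awalk_decomp[OF trav.awalkI_apath[OF t(2)] w] by blast
      have "set r \<subseteq> avoiding G (fst ` set p) v \<times> UNIV"
      proof
        fix s assume s: "s \<in> set r"
        obtain e c where ec: "s = (e, c)" by (cases s)
        have "tail (traversals G) s \<in> set (trav.awalk_verts a' p)"
          "head (traversals G) s \<in> set (trav.awalk_verts a' p)"
          using s qr(1) trav.awalk_verts_arc1[of s p a']
            trav.awalk_verts_arc2[OF trav.awalkI_apath[OF t(2)], of s] by auto
        then have "tail G e \<noteq> v" "head G e \<noteq> v" using t(3) True ec by (auto split: if_splits)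
        moreover have "e \<in> fst ` set p" using s qr(1) ec by force
        ultimately show "s \<in> avoiding G (fst ` set p) v \<times> UNIV" using ec by (simp add: avoiding_def)
      qed
      then have "(w, b) \<in> (?r p)\<^sup>*"
        using awalk_imp_steps[OF qr(2)] by (meson rtrancl_mono steps_mono subsetD)
      moreover have "b \<noteq> v"
        using t(3) True trav.awlast_of_awalk[OF trav.awalkI_apath[OF t(2)]] by (metis trav.awalkE' trav.awalkI_apath t(2) last_in_set trav.awalk_verts_non_Nil)
      ultimately show ?thesis using mono by auto
    next
      case v: False
      obtain z where z: "z \<in> {a', b} - {v}" "(w, z) \<in> (?r p)\<^sup>*"
        using Cons.IH[OF t(2) w Cons.prems(3)] by auto
      show ?thesis
      proof (cases "z = b")
        case True
        then show ?thesis using z mono by auto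
      next
        case False
        then have "z = a'" "a' \<noteq> v" using z by auto
        obtain e c where ec: "t = (e, c)" by (cases t)
        \<comment> \<open>Neither end of the first arc is \<open>v\<close>, so that arc survives and
          leads from \<open>a'\<close> back to \<open>a\<close>.\<close>
        have "e \<in> avoiding G (fst ` set (t # p)) v"
          using v \<open>a' \<noteq> v\<close> t(1) ec by (auto simp: avoiding_def a'_def split: if_splits)
        then have "(a', a) \<in> ?r (t # p)"
          using t(1) ec by (auto simp: steps_undirected a'_def split: if_splits)
        then have "(w, a) \<in> (?r (t # p))\<^sup>*"
          using z mono \<open>z = a'\<close> by (meson rtrancl_into_rtrancl subsetD)
        then show ?thesis using v by auto
      qed
    qed
  qed
qed

definition add_path :: "('a,'b) pre_digraph \<Rightarrow> 'a \<Rightarrow> ('b \<times> bool) list \<Rightarrow> ('a,'b) pre_digraph" where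
  "add_path H a p = \<lparr> verts = verts H \<union> set (trav.awalk_verts a p), arcs = arcs H \<union> fst ` set p,
     tail = tail G, head = head G \<rparr>"

lemma add_path_simps [simp]:
  "verts (add_path H a p) = verts H \<union> set (trav.awalk_verts a p)"
  "arcs (add_path H a p) = arcs H \<union> fst ` set p"
  "tail (add_path H a p) = tail G" "head (add_path H a p) = head G"
  by (simp_all add: add_path_def)

lemma add_path_subgraph:
  assumes "subgraph H G" "trav.awalk a p b"
  shows "subgraph (add_path H a p) G" "subgraph H (add_path H a p)"
proof -
  have H: "wf_digraph H" "tail H = tail G" "head H = head G" "verts H \<subseteq> verts G" "arcs H \<subseteq> arcs G"
    using assms(1) by (auto simp: subgraph_def compatible_def)
  have "tail G e \<in> set (trav.awalk_verts a p) \<and> head G e \<in> set (trav.awalk_verts a p)"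
    if "(e, c) \<in> set p" for e c
    using trav.awalk_verts_arc1[OF that, of a] trav.awalk_verts_arc2[OF assms(2) that]
    by (auto split: if_splits)
  moreover have "tail G e \<in> verts H \<and> head G e \<in> verts H" if "e \<in> arcs H" for e
    using wf_digraph.wellformed[OF H(1) that] H by simp
  ultimately have wf: "wf_digraph (add_path H a p)"
    by unfold_locales auto
  have "set (trav.awalk_verts a p) \<subseteq> verts G" "fst ` set p \<subseteq> arcs G"
    using trav.awalk_conv[of a p b] assms(2) by force+
  then show "subgraph (add_path H a p) G" "subgraph H (add_path H a p)"
    using wf H wf_digraph by (auto simp: subgraph_def compatible_def)
qed

text \<open>After deleting \<open>v\<close>, each remaining vertex of the path still reaches an end
  of the path other than \<open>v\<close>. That end lies in \<open>H\<close>, whose vertices other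
  than \<open>v\<close> stay joined to each other.\<close>

lemma add_path_nonseparable:
  assumes "subgraph H G" "Digraph_Component.connected H" "\<not> separable H"
    and "a \<in> verts H" "b \<in> verts H" "a \<noteq> b" "trav.apath a p b"
  shows "Digraph_Component.connected (add_path H a p)" "\<not> separable (add_path H a p)"
proof -
  let ?H = "add_path H a p"
  have walk: "trav.awalk a p b" using assms(7) by (rule trav.awalkI_apath)
  interpret H: wf_digraph H using assms(1) by (simp add: subgraph_def)
  interpret H': wf_digraph ?H using add_path_subgraph[OF assms(1) walk] by (simp add: subgraph_def)
  have ends: "tail H = tail G" "head H = head G"
    using assms(1) by (auto simp: subgraph_def compatible_def)
  have steps: "steps H = steps G" "steps ?H = steps G"
    by (intro ext steps_cong; simp add: ends)+
  have avoid: "avoiding H = avoiding G" "avoiding ?H = avoiding G"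
    by (auto simp: avoiding_def fun_eq_iff ends)
  show conn: "Digraph_Component.connected ?H"
  proof -
    let ?r = "steps G (arcs ?H \<times> UNIV)"
    have to_a: "(x, a) \<in> ?r\<^sup>*" if "x \<in> verts ?H" for x
    proof (cases "x \<in> verts H")
      case True
      then have "(x, a) \<in> (steps G (arcs H \<times> UNIV))\<^sup>*"
        using assms(2,4) by (simp add: H.connected_iff_steps steps)
      then show ?thesis
        using rtrancl_mono[OF steps_mono, of "arcs H \<times> UNIV" "arcs ?H \<times> UNIV" G] by auto
    next
      case False
      then have "x \<in> set (trav.awalk_verts a p)" using that by simp
      then obtain q r where qr: "p = q @ r" "trav.awalk a q x"
        using trav.awalk_decomp[OF walk] by blast
      have "set q \<subseteq> arcs ?H \<times> UNIV" using qr(1) by force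
      then have "(a, x) \<in> ?r\<^sup>*"
        using awalk_imp_steps[OF qr(2)] by (meson rtrancl_mono steps_mono subsetD)
      then show ?thesis by (rule steps_undirected_sym)
    qed
    have "(x, y) \<in> ?r\<^sup>*" if "x \<in> verts ?H" "y \<in> verts ?H" for x y
      by (rule rtrancl_trans[OF to_a[OF that(1)] steps_undirected_sym[OF to_a[OF that(2)]]])
    then show ?thesis using assms(4) by (auto simp: H'.connected_iff_steps steps simp del: add_path_simps(2))
  qed
  have "(x, y) \<in> (steps G (avoiding G (arcs ?H) v \<times> UNIV))\<^sup>*"
    if xy: "x \<in> verts ?H - {v}" "y \<in> verts ?H - {v}" for v x y
  proof -
    let ?r = "steps G (avoiding G (arcs ?H) v \<times> UNIV)"
    have to_H: "\<exists>z \<in> verts H - {v}. (x, z) \<in> ?r\<^sup>*" if "x \<in> verts ?H - {v}" for x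
    proof (cases "x \<in> verts H")
      case False
      then have "x \<in> set (trav.awalk_verts a p)" "x \<noteq> v" using that by auto
      from apath_avoiding[OF assms(7) this]
      obtain z where z: "z \<in> {a, b} - {v}" "(x, z) \<in> (steps G (avoiding G (fst ` set p) v \<times> UNIV))\<^sup>*"
        by (elim bexE)
      have "avoiding G (fst ` set p) v \<times> UNIV \<subseteq> avoiding G (arcs ?H) v \<times> (UNIV :: bool set)"
        by (auto simp: avoiding_def)
      then have "(x, z) \<in> ?r\<^sup>*" using z(2) by (meson rtrancl_mono steps_mono subsetD)
      then show ?thesis using z(1) assms(4,5) by auto
    qed (use that in auto)
    obtain x' y' where x': "x' \<in> verts H - {v}" "(x, x') \<in> ?r\<^sup>*" and y': "y' \<in> verts H - {v}" "(y, y') \<in> ?r\<^sup>*"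
      using to_H xy by meson
    have "(x', y') \<in> (steps G (avoiding G (arcs H) v \<times> UNIV))\<^sup>*"
      using assms(3) x'(1) y'(1) by (auto simp: H.not_separable_iff_steps[OF assms(2)] steps avoid)
    moreover have "avoiding G (arcs H) v \<times> UNIV \<subseteq> avoiding G (arcs ?H) v \<times> (UNIV :: bool set)"
      by (auto simp: avoiding_def)
    ultimately have "(x', y') \<in> ?r\<^sup>*" by (meson rtrancl_mono steps_mono subsetD)
    with x'(2) have "(x, y') \<in> ?r\<^sup>*" by (rule rtrancl_trans)
    then show ?thesis using steps_undirected_sym[OF y'(2)] by (rule rtrancl_trans)
  qed
  then show "\<not> separable ?H"
    by (simp only: H'.not_separable_iff_steps[OF conn] steps avoid) blast
qed

end

text \<open>Among the connected non-separable subgraphs containing \<open>H\<close>, one with the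
  most vertices and arcs is maximal, since by finiteness a proper enlargement would increase the
  count.\<close>

lemma (in fin_digraph) block_exists:
  assumes "subgraph H G" "Digraph_Component.connected H" "\<not> separable H"
  obtains H' where "block G H'" "subgraph H H'"
proof -
  define P where "P K \<longleftrightarrow> subgraph K G \<and> Digraph_Component.connected K \<and> \<not> separable K \<and> subgraph H K" for K
  define size where "size K = card (verts K) + card (arcs K)" for K :: "('a,'b) pre_digraph"
  have "P H" using assms by (auto simp: P_def subgraph_def compatible_def)
  moreover have "size K \<le> card (verts G) + card (arcs G)" if "P K" for K
    using that unfolding P_def size_def subgraph_def by (auto intro!: add_mono card_mono)
  ultimately obtain K where K: "P K" "\<And>K'. P K' \<Longrightarrow> size K' \<le> size K"
    using ex_has_greatest_nat[of P H size "Suc (card (verts G) + card (arcs G))"] by (metis le_imp_less_Suc)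
  have "K' = K" if "subgraph K K'" "subgraph K' G" "Digraph_Component.connected K'" "\<not> separable K'" for K'
  proof -
    have "P K'" using that K(1) subgraph_trans by (auto simp: P_def)
    then have le: "size K' \<le> size K" by (rule K(2))
    have sub: "verts K \<subseteq> verts K'" "arcs K \<subseteq> arcs K'" using that by (auto simp: subgraph_def)
    have "finite (verts K')" "finite (arcs K')"
      using that(2) finite_subset[of _ "verts G"] finite_subset[of _ "arcs G"] by (auto simp: subgraph_def)
    then have "verts K = verts K' \<and> arcs K = arcs K'"
      using le sub card_mono[of "verts K'" "verts K"] card_mono[of "arcs K'" "arcs K"]
        card_subset_eq[of "verts K'" "verts K"] card_subset_eq[of "arcs K'" "arcs K"]
      unfolding size_def by linarith
    moreover have "tail K = tail K'" "head K = head K'" using that(1) by (auto simp: subgraph_def compatible_def)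
    ultimately show ?thesis by simp
  qed
  then have "block G K" using K(1) unfolding block_def max_subgraph_def P_def by blast
  then show ?thesis using that K(1) by (auto simp: P_def)
qed

section \<open>From spanning forward cycles to returning arcs\<close>

context fin_digraph
begin

interpretation trav: wf_digraph "traversals G"
  by (rule wf_traversals)

text \<open>The non-bridge \<open>e\<close> lies on an undirected cycle, whose vector is nonzero at
  \<open>e\<close>. So some basis element uses \<open>e\<close>; being a directed cycle, it provides
  the return walk.\<close>

lemma spanned_imp_returning:
  assumes "forward G B" "basis_of (over ` B) (cycle_space G :: ('b \<Rightarrow> 'k::field) set)"
    and "e \<in> arcs G" "(tail G e, head G e) \<in> (steps G ((arcs G - {e}) \<times> UNIV))\<^sup>*"
  shows "e \<in> returning"
proof -
  obtain p where p: "ucycle G ((e, True) # p)"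
    using ucycle_through[OF assms(3) steps_undirected_sym[OF assms(4)]] by auto
  let ?x = "over (incidence ((e, True) # p)) :: 'b \<Rightarrow> 'k"
  have "?x = of_int \<circ> incidence ((e, True) # p)" by (auto simp: over_def)
  then have "?x \<in> cycle_space G" using ucycle_circulation[OF p] by (simp add: cycle_space_eq)
  then have "?x \<in> module.span vscale (over ` B)" using assms(2) by (simp add: basis_of_def)
  moreover have "?x e \<noteq> 0" by (simp add: over_def incidence_def)
  ultimately obtain C where C: "C \<in> B" "(over C :: 'b \<Rightarrow> 'k) e \<noteq> 0"
    using span_vscale_vanishing[of ?x "over ` B" e] by (metis imageE)
  then obtain q where q: "directed_cycle G q" "C = incidence q"
    using assms(1) by (auto simp: forward_def directed_cycles_def)
  have "e \<in> fst ` set q" using C(2) incidence_outside[of e q] q(2) by (metis of_int_0 over_def)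
  then have "(e, True) \<in> set q" using q(1) by (auto simp: directed_cycle_def)
  then have "(head G e, tail G e) \<in> (steps G {t \<in> set q. fst t \<noteq> e})\<^sup>*"
    using ucycle_return[of q e True] q(1) by (simp add: directed_cycle_def)
  moreover have "{t \<in> set q. fst t \<noteq> e} \<subseteq> arcs G \<times> {True}"
    using q(1) ucycle_arcs[of q] by (fastforce simp: directed_cycle_def)
  ultimately have "(head G e, tail G e) \<in> (steps G (arcs G \<times> {True}))\<^sup>*"
    by (rule steps_rtrancl_mono)
  then show ?thesis using assms(3) by (simp add: returning_def)
qed

end

section \<open>Returning arcs and blocks\<close>

context fin_loopfree_digraph
begin

interpretation trav: wf_digraph "traversals G"
  by (rule wf_traversals)

text \<open>If all arcs of \<open>H\<close> return, they return inside \<open>H\<close> by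
  maximality. Otherwise some arc of \<open>H\<close> is a bridge of \<open>G\<close>, and a third
  vertex or a second arc in \<open>H\<close> would yield a detour around it.\<close>

lemma block_strong_or_single_arc:
  assumes "block G H"
    and bridge_or_returning:
      "\<And>e. e \<in> arcs G \<Longrightarrow> (tail G e, head G e) \<in> (steps G ((arcs G - {e}) \<times> UNIV))\<^sup>* \<Longrightarrow> e \<in> returning"
  shows "strongly_connected H \<or> single_arc H"
proof -
  have H: "subgraph H G" "Digraph_Component.connected H" "\<not> separable H"
    and max: "\<And>H'. subgraph H H' \<Longrightarrow> subgraph H' G \<Longrightarrow> Digraph_Component.connected H' \<Longrightarrow>
      \<not> separable H' \<Longrightarrow> H' = H"
    using assms(1) by (auto simp: block_def max_subgraph_def)
  interpret H: wf_digraph H using H(1) by (simp add: subgraph_def)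
  have ends: "tail H = tail G" "head H = head G" and arcs: "arcs H \<subseteq> arcs G"
    using H(1) by (auto simp: subgraph_def compatible_def)
  have steps: "steps H = steps G" by (intro ext steps_cong) (simp_all add: ends)
  have avoid: "avoiding H = avoiding G" by (auto simp: avoiding_def fun_eq_iff ends)
  show ?thesis
  proof (cases "arcs H \<subseteq> returning")
    case True
    have "(head G e, tail G e) \<in> (steps G (arcs H \<times> {True}))\<^sup>*" if e: "e \<in> arcs H" for e
    proof -
      have "(head G e, tail G e) \<in> (steps G (arcs G \<times> {True}))\<^sup>*" "head G e \<in> verts G"
        using e True arcs by (auto simp: returning_def)
      then obtain p where p: "trav.apath (head G e) p (tail G e)" "set p \<subseteq> arcs G \<times> {True}"
        using steps_imp_apath[of "head G e" "tail G e" "arcs G \<times> {True}"] by blast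
      \<comment> \<open>The return path is attached at the two ends of \<open>e\<close>, distinct
        for lack of loops; so the block already contains it.\<close>
      have "add_path H (head G e) p = H"
      proof (rule max)
        have e_ends: "head G e \<in> verts H" "tail G e \<in> verts H" "head G e \<noteq> tail G e"
          using e H.wellformed[OF e] ends arcs no_loops[of e] by auto
        show "Digraph_Component.connected (add_path H (head G e) p)" "\<not> separable (add_path H (head G e) p)"
          by (rule add_path_nonseparable[OF H e_ends p(1)])+
        show "subgraph H (add_path H (head G e) p)" "subgraph (add_path H (head G e) p) G"
          by (rule add_path_subgraph[OF H(1) trav.awalkI_apath[OF p(1)]])+
      qed
      then have "fst ` set p \<subseteq> arcs H" by (metis add_path_simps(2) Un_upper2)
      then have "set p \<subseteq> arcs H \<times> {True}" using p(2) by force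
      with awalk_imp_steps[OF trav.awalkI_apath[OF p(1)]] show ?thesis by (rule steps_rtrancl_mono)
    qed
    \<comment> \<open>Each undirected step is now a directed walk in \<open>H\<close>, which turns
      connectedness into strong connectedness.\<close>
    then have "steps G (arcs H \<times> UNIV) \<subseteq> (steps G (arcs H \<times> {True}))\<^sup>*"
      using steps_forwardI[of _ "arcs H" G] by (auto simp: steps_undirected)
    then have "(steps G (arcs H \<times> UNIV))\<^sup>* \<subseteq> (steps G (arcs H \<times> {True}))\<^sup>*"
      by (metis rtrancl_mono rtrancl_idemp)
    then have "strongly_connected H"
      using H(2) by (auto simp: H.strongly_connected_iff_steps H.connected_iff_steps steps)
    then show ?thesis ..
  next
    case False
    then obtain e where e: "e \<in> arcs H" "e \<notin> returning" by auto
    let ?a = "tail G e" and ?b = "head G e"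
    let ?r = "steps G ((arcs G - {e}) \<times> UNIV)"
    have bridge: "(?a, ?b) \<notin> ?r\<^sup>*" using e arcs bridge_or_returning by auto
    have ab: "?a \<in> verts H" "?b \<in> verts H" "?a \<noteq> ?b"
      using H.wellformed[OF e(1)] ends no_loops[of e] e arcs by auto
    have verts: "verts H = {?a, ?b}"
    proof (rule ccontr)
      assume "verts H \<noteq> {?a, ?b}"
      then obtain w where w: "w \<in> verts H" "w \<noteq> ?a" "w \<noteq> ?b" using ab by auto
      \<comment> \<open>Deleting an end of \<open>e\<close> also removes \<open>e\<close>, so what
        stays joined in \<open>H\<close> is joined without \<open>e\<close>. Deleting the head joins
        the tail to \<open>w\<close>, and deleting the tail joins \<open>w\<close> to the
        head.\<close>
      have joined: "(x, y) \<in> ?r\<^sup>*"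
        if "v = ?a \<or> v = ?b" "x \<in> verts H - {v}" "y \<in> verts H - {v}" for v x y
      proof -
        have "(x, y) \<in> (steps G (avoiding G (arcs H) v \<times> UNIV))\<^sup>*"
          using H(3) that(2,3) by (auto simp: H.not_separable_iff_steps[OF H(2)] steps avoid)
        moreover have "avoiding G (arcs H) v \<times> UNIV \<subseteq> (arcs G - {e}) \<times> (UNIV :: bool set)"
          using that(1) arcs by (auto simp: avoiding_def)
        ultimately show ?thesis by (rule steps_rtrancl_mono)
      qed
      have "(?a, w) \<in> ?r\<^sup>*" using joined[of ?b] w ab by auto
      also have "(w, ?b) \<in> ?r\<^sup>*" using joined[of ?a] w ab by auto
      finally show False using bridge by simp
    qed
    have "f = e" if "f \<in> arcs H" for f
    proof (rule ccontr)
      assume "f \<noteq> e"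
      then have "(tail G f, head G f) \<in> ?r" "(head G f, tail G f) \<in> ?r"
        using that arcs by (auto simp: steps_undirected)
      \<comment> \<open>A second arc without loops on two vertices is parallel or antiparallel to
        \<open>e\<close>, so it bypasses \<open>e\<close>.\<close>
      moreover have "{tail G f, head G f} = {?a, ?b}"
        using H.wellformed[OF that] ends verts no_loops[of f] that arcs by auto
      ultimately show False using bridge by (auto simp: doubleton_eq_iff)
    qed
    then have "arcs H = {e}" using e(1) by blast
    then have "single_arc H" using verts ends unfolding single_arc_def by metis
    then show ?thesis ..
  qed
qed

text \<open>The arc \<open>e\<close> with a return path avoiding it is connected and non-separable,
  so it extends to a block. Having at least two arcs, this block is strongly connected and brings
  the head of \<open>e\<close> back to its tail.\<close>

lemma returning_if_blocks:
  assumes blocks: "\<And>H. block G H \<Longrightarrow> strongly_connected H \<or> single_arc H"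
    and e: "e \<in> arcs G" "(tail G e, head G e) \<in> (steps G ((arcs G - {e}) \<times> UNIV))\<^sup>*"
  shows "e \<in> returning"
proof -
  let ?a = "tail G e" and ?b = "head G e"
  define E where "E = \<lparr> verts = {?a, ?b}, arcs = {e}, tail = tail G, head = head G \<rparr>"
  interpret E: wf_digraph E by unfold_locales (auto simp: E_def)
  have E: "subgraph E G"
    using e(1) E.wf_digraph wf_digraph by (auto simp: subgraph_def compatible_def E_def)
  have "(?a, ?b) \<in> (steps E (arcs E \<times> UNIV))" "(?b, ?a) \<in> (steps E (arcs E \<times> UNIV))"
    by (auto simp: steps_undirected E_def)
  then have conn: "Digraph_Component.connected E"
    by (auto simp: E.connected_iff_steps) (auto simp: E_def)
  have nonsep: "\<not> separable E"
    unfolding E.not_separable_iff_steps[OF conn]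
  proof (intro allI ballI)
    fix v x y assume xy: "x \<in> verts E - {v}" "y \<in> verts E - {v}"
    show "(x, y) \<in> (steps E (avoiding E (arcs E) v \<times> UNIV))\<^sup>*"
    proof (cases "v \<in> verts E")
      case True
      \<comment> \<open>Removing one of the two vertices leaves at most one.\<close>
      then have "x = y" using xy by (auto simp: E_def)
      then show ?thesis by simp
    next
      case False
      then have "avoiding E (arcs E) v = arcs E" by (auto simp: avoiding_def E_def)
      then show ?thesis using conn xy by (simp add: E.connected_iff_steps)
    qed
  qed
  obtain p where p: "trav.apath ?b p ?a" "set p \<subseteq> (arcs G - {e}) \<times> UNIV"
    using steps_imp_apath[OF steps_undirected_sym[OF e(2)]] e(1) by auto
  have ab: "?b \<in> verts E" "?a \<in> verts E" "?b \<noteq> ?a" using no_loops[OF e(1)] by (auto simp: E_def)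
  note sub = add_path_subgraph[OF E trav.awalkI_apath[OF p(1)]]
  obtain H where H: "block G H" "subgraph (add_path E ?b p) H"
    using block_exists[OF sub(1) add_path_nonseparable[OF E conn nonsep ab p(1)]] .
  \<comment> \<open>The ends of \<open>e\<close> differ, so the return path has an arc, and that arc
    is not \<open>e\<close>.\<close>
  have "p \<noteq> []" using p(1) ab(3) by (auto simp: trav.apath_Nil_iff)
  then obtain f where "f \<in> fst ` set p" by (cases p) auto
  moreover have "fst ` set p \<subseteq> arcs H" "e \<in> arcs H"
    using H(2) by (auto simp: subgraph_def E_def)
  ultimately have "\<not> single_arc H" using p(2) by (fastforce simp: single_arc_def)
  then have "strongly_connected H" using blocks[OF H(1)] by simp
  moreover have HG: "subgraph H G" using H(1) by (simp add: block_def max_subgraph_def)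
  then interpret H: wf_digraph H by (simp add: subgraph_def)
  have ends: "tail H = tail G" "head H = head G" and arcs: "arcs H \<subseteq> arcs G"
    using HG by (auto simp: subgraph_def compatible_def)
  have "steps H = steps G" by (intro ext steps_cong) (simp_all add: ends)
  ultimately have "(?b, ?a) \<in> (steps G (arcs H \<times> {True}))\<^sup>*"
    using H.wellformed[OF \<open>e \<in> arcs H\<close>] by (simp add: H.strongly_connected_iff_steps ends)
  moreover have "arcs H \<times> {True} \<subseteq> arcs G \<times> {True}" using arcs by auto
  ultimately have "(?b, ?a) \<in> (steps G (arcs G \<times> {True}))\<^sup>*"
    by (rule steps_rtrancl_mono)
  then show ?thesis using e(1) by (simp add: returning_def)
qed

end

section \<open>The equivalence of the five conditions\<close>

theorem proposition3p1:
  fixes D :: "('a,'b) pre_digraph"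
  assumes "fin_loopfree_digraph D"
  shows
    "((\<exists>B. forward D B \<and> weakly_fundamental_cycle_basis D B) \<longleftrightarrow>
      (\<exists>B. forward D B \<and> integral_cycle_basis D B)) \<and>
     ((\<exists>B. forward D B \<and> integral_cycle_basis D B) \<longleftrightarrow>
      (\<exists>B. forward D B \<and> undirected_cycle_basis D B)) \<and>
     ((\<exists>B. forward D B \<and> undirected_cycle_basis D B) \<longleftrightarrow>
      (\<exists>B. forward D B \<and> directed_cycle_basis D B)) \<and>
     ((\<exists>B. forward D B \<and> directed_cycle_basis D B) \<longleftrightarrow>
      (\<forall>H. block D H \<longrightarrow> strongly_connected H \<or> single_arc H))"
proof -
  interpret fin_loopfree_digraph D by fact
  \<comment> \<open>The common condition: every arc that is not a bridge returns.\<close>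
  define R where "R \<longleftrightarrow> (\<forall>e \<in> arcs D.
    (tail D e, head D e) \<in> (steps D ((arcs D - {e}) \<times> UNIV))\<^sup>* \<longrightarrow> e \<in> returning)"
  have blocks: "R \<longleftrightarrow> (\<forall>H. block D H \<longrightarrow> strongly_connected H \<or> single_arc H)"
  proof
    show "\<forall>H. block D H \<longrightarrow> strongly_connected H \<or> single_arc H" if R
      using block_strong_or_single_arc that by (simp add: R_def)
    show R if "\<forall>H. block D H \<longrightarrow> strongly_connected H \<or> single_arc H"
      using returning_if_blocks that by (simp add: R_def)
  qed
  have bases: "\<exists>B. forward D B \<and> weakly_fundamental_cycle_basis D B"
    "\<exists>B. forward D B \<and> integral_cycle_basis D B"
    "\<exists>B. forward D B \<and> undirected_cycle_basis D B" if R
  proof -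
    obtain Cs where Cs: "cyclic_growth D returning Cs" using cyclic_growth_returning by blast
    have "e \<in> returning"
      if "e \<in> arcs D" "(tail D e, head D e) \<in> (steps D ((arcs D - {e}) \<times> UNIV))\<^sup>*" for e
      using \<open>R\<close> that by (simp add: R_def)
    note Cs_bases = cyclic_growth_bases[OF Cs this]
    show "\<exists>B. forward D B \<and> weakly_fundamental_cycle_basis D B"
      "\<exists>B. forward D B \<and> integral_cycle_basis D B"
      "\<exists>B. forward D B \<and> undirected_cycle_basis D B"
      using Cs_bases(1) Cs_bases(2-4) by blast+
  qed
  \<comment> \<open>The real and the mod 2 case are separate instances of the same field argument;
    the weakly fundamental and integral bases are directed ones by definition.\<close>
  have real: R if "forward D B" "directed_cycle_basis D B" for B
    using spanned_imp_returning[OF that(1)] that(2) by (auto simp: R_def directed_cycle_basis_def)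
  have bit: R if "forward D B" "undirected_cycle_basis D B" for B
    using spanned_imp_returning[OF that(1)] that(2) by (auto simp: R_def undirected_cycle_basis_def)
  have "directed_cycle_basis D B" if "weakly_fundamental_cycle_basis D B \<or> integral_cycle_basis D B" for B
    using that by (auto simp: weakly_fundamental_cycle_basis_def integral_cycle_basis_def)
  then show ?thesis using blocks bases real bit by blast
qed

end
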